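(* For every $p\in P^*$ there is an ultrafilter $q\in P^*$ with $q\neq p$ such that there are $2^{\mathfrak{c}}$ ultrafilters $r\in\beta N$ with $r\supseteq F_{1,1}^{p,q}$.
   Context: $N=\{1,2,3,\dots\}$; $\beta N$ is the set of ultrafilters on $N$. $P$ is the set of prime numbers; $P^*$ is the set of nonprincipal ultrafilters $p\in\beta N$ with $P\in p$. For $p$ with $P\in p$, $p\restriction P=\{X\cap P: X\in p\}$. For $A,B\subseteq N$, $AB=\{ab: a\in A,\ b\in B,\ \gcd(a,b)=1\}$. $F_{1,1}^{p,q}=\{AB: A\in p\restriction P,\ B\in q\restriction P,\ A\cap B=\emptyset\}$. $\mathfrak{c}=2^{\aleph_0}$. *)

theory Defs
  imports "HOL-Library.Equipollence" "HOL-Computational_Algebra.Primes"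
begin

text \<open>
  Ultrafilters are families of subsets of an explicit carrier, because the underlying
  set $\{1,2,3,\dots\}$ is not the whole type \<^typ>\<open>nat\<close>.
\<close>

definition ultrafilter_on :: "'a set \<Rightarrow> 'a set set \<Rightarrow> bool" where
  "ultrafilter_on S u \<longleftrightarrow>
     u \<subseteq> Pow S \<and> S \<in> u \<and> {} \<notin> u \<and>
     (\<forall>X\<in>u. \<forall>Y\<in>u. X \<inter> Y \<in> u) \<and>
     (\<forall>X\<in>u. \<forall>Y. X \<subseteq> Y \<and> Y \<subseteq> S \<longrightarrow> Y \<in> u) \<and>
     (\<forall>X. X \<subseteq> S \<longrightarrow> X \<in> u \<or> S - X \<in> u)"

definition principal_on :: "'a set \<Rightarrow> 'a set set \<Rightarrow> bool" where
  "principal_on S u \<longleftrightarrow> (\<exists>a\<in>S. u = {X. X \<subseteq> S \<and> a \<in> X})"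

definition posnats :: "nat set" where
  "posnats = {1..}"

definition betaN :: "nat set set set" where
  "betaN = {u. ultrafilter_on posnats u}"

definition Primes :: "nat set" where
  "Primes = {n. prime n}"

definition Primes_star :: "nat set set set" where
  "Primes_star = {p \<in> betaN. \<not> principal_on posnats p \<and> Primes \<in> p}"

definition restrict_family :: "'a set set \<Rightarrow> 'a set \<Rightarrow> 'a set set" where
  "restrict_family u S = {X \<inter> S | X. X \<in> u}"

definition coprime_prod :: "nat set \<Rightarrow> nat set \<Rightarrow> nat set" where
  "coprime_prod A B = {a * b | a b. a \<in> A \<and> b \<in> B \<and> gcd a b = 1}"

definition F11 :: "nat set set \<Rightarrow> nat set set \<Rightarrow> nat set set" where
  "F11 p q = {coprime_prod A B | A B.
     A \<in> restrict_family p Primes \<and> B \<in> restrict_family q Primes \<and> A \<inter> B = {}}"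

end

(* It is enough to find infinitely many suitable ultrafilters w i with w i \<supseteq> F11 p q: every limit
   of the w i along an ultrafilter u on the natural numbers again contains F11 p q, and if the
   w i can be separated by sets, different u give different limits. There are 2^c choices of u
   (Pospisil's theorem). To get the w i, split the primes into A \<in> p and an infinite complement, and
   code the finite sequences s of naturals by primes e(s) in that complement. Let v be an
   ultrafilter on finite sequences containing, for all n and all X \<in> p, the set of injective
   sequences in X of length > n. Then q is the image of v under e, and w i is the image of v under
   s |-> s(i) e(s): the i-th coordinate sends v to p, for every i. *)
theory Submission
  imports Defs "HOL-Library.Countable"
begin

section \<open>Ultrafilters on a carrier\<close>

context
  fixes S :: "'a set" and u :: "'a set set"
  assumes u: "ultrafilter_on S u"
begin

lemma ultrafilter_on_subset: "X \<in> u \<Longrightarrow> X \<subseteq> S"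
  using u unfolding ultrafilter_on_def by blast

lemma ultrafilter_on_carrier: "S \<in> u"
  using u unfolding ultrafilter_on_def by blast

lemma ultrafilter_on_empty: "{} \<notin> u"
  using u unfolding ultrafilter_on_def by blast

lemma ultrafilter_on_Int: "X \<in> u \<Longrightarrow> Y \<in> u \<Longrightarrow> X \<inter> Y \<in> u"
  using u unfolding ultrafilter_on_def by blast

lemma ultrafilter_on_mono: "X \<in> u \<Longrightarrow> X \<subseteq> Y \<Longrightarrow> Y \<subseteq> S \<Longrightarrow> Y \<in> u"
  using u unfolding ultrafilter_on_def by blast

lemma ultrafilter_on_Diff: "X \<subseteq> S \<Longrightarrow> X \<notin> u \<Longrightarrow> S - X \<in> u"
  using u unfolding ultrafilter_on_def by blast

lemma ultrafilter_on_disjoint: "X \<in> u \<Longrightarrow> Y \<in> u \<Longrightarrow> X \<inter> Y \<noteq> {}"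
  using ultrafilter_on_Int ultrafilter_on_empty by metis

lemma ultrafilter_on_Diff_iff: "X \<subseteq> S \<Longrightarrow> S - X \<in> u \<longleftrightarrow> X \<notin> u"
  using ultrafilter_on_Diff ultrafilter_on_disjoint[of X "S - X"] by blast

lemma ultrafilter_on_Int_iff:
  "X \<subseteq> S \<Longrightarrow> Y \<subseteq> S \<Longrightarrow> X \<inter> Y \<in> u \<longleftrightarrow> X \<in> u \<and> Y \<in> u"
  using ultrafilter_on_Int ultrafilter_on_mono by blast

text \<open>Peel off the points of X one at a time: either \<open>{a}\<close> belongs to u, which
  makes u principal at a, or its complement does, and then a can be removed from X.\<close>

lemma ultrafilter_on_finite_principal:
  assumes "finite X" "X \<in> u"
  shows "principal_on S u"
  using assms
proof (induction X rule: finite_induct)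
  case empty
  then show ?case using ultrafilter_on_empty by blast
next
  case (insert a X)
  have aS: "a \<in> S" using insert.prems ultrafilter_on_subset by blast
  show ?case
  proof (cases "{a} \<in> u")
    case True
    have "X \<in> u \<longleftrightarrow> X \<subseteq> S \<and> a \<in> X" for X
      using ultrafilter_on_subset[of X] ultrafilter_on_mono[OF True, of X]
        ultrafilter_on_disjoint[OF True, of X] by auto
    then have "u = {X. X \<subseteq> S \<and> a \<in> X}" by blast
    then show ?thesis unfolding principal_on_def using aS by blast
  next
    case False
    then have "S - {a} \<in> u" using ultrafilter_on_Diff aS by blast
    then have "insert a X \<inter> (S - {a}) \<in> u" using insert.prems ultrafilter_on_Int by blast
    then have "X \<in> u"
      by (rule ultrafilter_on_mono) (use insert.prems ultrafilter_on_subset in blast)+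
    then show ?thesis using insert.IH by blast
  qed
qed

end

text \<open>Zorn's lemma gives a maximal family with the finite intersection property. A union of a
  chain keeps this property because a finite subfamily already lies in one link. Intersecting with S
  covers empty H, where \<open>\<Inter>H\<close> is \<open>UNIV\<close>.\<close>

lemma ultrafilter_on_extends:
  assumes "F \<subseteq> Pow S"
    and "\<And>H. finite H \<Longrightarrow> H \<subseteq> F \<Longrightarrow> S \<inter> \<Inter>H \<noteq> {}"
  shows "\<exists>u. ultrafilter_on S u \<and> F \<subseteq> u"
proof -
  define fip where "fip G \<longleftrightarrow> (\<forall>H. finite H \<longrightarrow> H \<subseteq> G \<longrightarrow> S \<inter> \<Inter>H \<noteq> {})" for G
  define Q where "Q = {G. F \<subseteq> G \<and> G \<subseteq> Pow S \<and> fip G}"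
  have "F \<in> Q" using assms unfolding Q_def fip_def by blast
  have "\<exists>M\<in>Q. \<forall>X\<in>Q. M \<subseteq> X \<longrightarrow> X = M"
  proof (rule subset_Zorn_nonempty)
    show "Q \<noteq> {}" using \<open>F \<in> Q\<close> by blast
    fix C assume C: "C \<noteq> {}" "subset.chain Q C"
    have CQ: "C \<subseteq> Q" using C(2) by (simp add: subset.chain_def)
    have "S \<inter> \<Inter>H \<noteq> {}" if H: "finite H" "H \<subseteq> \<Union>C" for H
    proof -
      obtain G where "G \<in> C" "H \<subseteq> G"
        using finite_subset_Union_chain[OF H C] by blast
      then show ?thesis using CQ H(1) unfolding Q_def fip_def by blast
    qed
    moreover have "F \<subseteq> \<Union>C" "\<Union>C \<subseteq> Pow S" using C(1) CQ unfolding Q_def by blast+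
    ultimately show "\<Union>C \<in> Q" unfolding Q_def fip_def by blast
  qed
  then obtain M where "M \<in> Q" and max: "\<And>X. X \<in> Q \<Longrightarrow> M \<subseteq> X \<Longrightarrow> X = M" by blast
  then have FM: "F \<subseteq> M" and MS: "M \<subseteq> Pow S" and
    fip: "\<And>H. finite H \<Longrightarrow> H \<subseteq> M \<Longrightarrow> S \<inter> \<Inter>H \<noteq> {}"
    by (simp_all add: Q_def fip_def)
  \<comment> \<open>Maximality in usable form: a set meeting every finite intersection from M can be
    adjoined, so it is already there. All closure properties below reduce to this.\<close>
  have in_M: "X \<in> M"
    if X: "X \<subseteq> S" and meets: "\<And>H. finite H \<Longrightarrow> H \<subseteq> M \<Longrightarrow> S \<inter> \<Inter>H \<inter> X \<noteq> {}" for X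
  proof -
    have "S \<inter> \<Inter>H \<noteq> {}" if H: "finite H" "H \<subseteq> insert X M" for H
      using meets[of "H - {X}"] H by blast
    moreover have "F \<subseteq> insert X M" "insert X M \<subseteq> Pow S" using FM MS X by auto
    ultimately have "insert X M \<in> Q" by (simp add: Q_def fip_def)
    then show ?thesis using max by blast
  qed
  have "ultrafilter_on S M"
    unfolding ultrafilter_on_def
  proof (intro conjI ballI allI impI)
    show "S \<in> M" using in_M[of S] fip by (simp add: Int_commute Int_left_commute)
    show "{} \<notin> M" using fip[of "{{}}"] by blast
  next
    fix X Y assume XY: "X \<in> M" "Y \<in> M"
    show "X \<inter> Y \<in> M"
    proof (rule in_M)
      show "X \<inter> Y \<subseteq> S" using XY MS by blast
      show "S \<inter> \<Inter>H \<inter> (X \<inter> Y) \<noteq> {}" if "finite H" "H \<subseteq> M" for H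
        using fip[of "insert X (insert Y H)"] XY that by (simp add: ac_simps)
    qed
  next
    fix X Y assume X: "X \<in> M" and Y: "X \<subseteq> Y \<and> Y \<subseteq> S"
    show "Y \<in> M"
    proof (rule in_M)
      show "S \<inter> \<Inter>H \<inter> Y \<noteq> {}" if "finite H" "H \<subseteq> M" for H
        using fip[of "insert X H"] X Y that by auto
    qed (use Y in blast)
  next
    fix X assume X: "X \<subseteq> S"
    show "X \<in> M \<or> S - X \<in> M"
    proof (rule disjCI)
      assume "S - X \<notin> M"
      \<comment> \<open>The finite intersection of H1 lies inside X, so any finite H meets X within
        the intersection of H and H1 together.\<close>
      then obtain H1 where H1: "finite H1" "H1 \<subseteq> M" "S \<inter> \<Inter>H1 \<inter> (S - X) = {}"
        using in_M[of "S - X"] by blast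
      show "X \<in> M"
      proof (rule in_M[OF X])
        fix H assume "finite H" "H \<subseteq> M"
        then have "S \<inter> \<Inter>(H \<union> H1) \<noteq> {}" using H1 by (intro fip) auto
        then show "S \<inter> \<Inter>H \<inter> X \<noteq> {}" using H1(3) by blast
      qed
    qed
  qed (use MS in blast)
  then show ?thesis using FM by blast
qed

section \<open>Images and limits of ultrafilters\<close>

definition ultrafilter_image :: "('a \<Rightarrow> 'b) \<Rightarrow> 'b set \<Rightarrow> 'a set set \<Rightarrow> 'b set set" where
  "ultrafilter_image f T v = {Y. Y \<subseteq> T \<and> f -` Y \<in> v}"

text \<open>It suffices that f lands in T on a set in v; values elsewhere are irrelevant. This
  permits maps such as \<open>s ! i\<close>, which is meaningful only on long enough lists.\<close>

lemma ultrafilter_on_image: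
  assumes v: "ultrafilter_on UNIV v" and "f -` T \<in> v"
  shows "ultrafilter_on T (ultrafilter_image f T v)"
proof -
  have "f -` (T - Y) = f -` T \<inter> (UNIV - f -` Y)" for Y by blast
  then have "f -` Y \<in> v \<or> f -` (T - Y) \<in> v" for Y
    using assms ultrafilter_on_Diff[OF v, of "f -` Y"] by (auto intro: ultrafilter_on_Int)
  moreover have "f -` Y \<in> v" if "f -` X \<in> v" "X \<subseteq> Y" for X Y
    using ultrafilter_on_mono[OF v that(1), of "f -` Y"] that(2) by blast
  ultimately show ?thesis
    using assms(2) ultrafilter_on_empty[OF v] ultrafilter_on_Int[OF v]
    unfolding ultrafilter_on_def ultrafilter_image_def
    by (auto simp: vimage_Int)
qed

text \<open>This is the limit of the points \<open>w i\<close> along u in the compact space of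
  ultrafilters on T.\<close>

definition ultrafilter_limit :: "'i set set \<Rightarrow> 'a set \<Rightarrow> ('i \<Rightarrow> 'a set set) \<Rightarrow> 'a set set" where
  "ultrafilter_limit u T w = {Y. Y \<subseteq> T \<and> {i. Y \<in> w i} \<in> u}"

text \<open>Since each \<open>w i\<close> is an ultrafilter, the map from X to
  \<open>{i. X \<in> w i}\<close> preserves intersections and complements, so the axioms pull back
  from u.\<close>

lemma ultrafilter_on_limit:
  assumes u: "ultrafilter_on UNIV u" and w: "\<And>i. ultrafilter_on T (w i)"
  shows "ultrafilter_on T (ultrafilter_limit u T w)"
proof -
  have 1: "{i. T \<in> w i} = UNIV" "{i. {} \<in> w i} = {}"
    using ultrafilter_on_carrier[OF w] ultrafilter_on_empty[OF w] by auto
  have 2: "{i. X \<inter> Y \<in> w i} = {i. X \<in> w i} \<inter> {i. Y \<in> w i}"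
    if "X \<subseteq> T" "Y \<subseteq> T" for X Y
    using ultrafilter_on_Int_iff[OF w that] by auto
  have 3: "{i. T - X \<in> w i} = UNIV - {i. X \<in> w i}" if "X \<subseteq> T" for X
    using ultrafilter_on_Diff_iff[OF w that] by auto
  have 4: "{i. Y \<in> w i} \<in> u" if "{i. X \<in> w i} \<in> u" "X \<subseteq> Y" "Y \<subseteq> T" for X Y
    using ultrafilter_on_mono[OF u that(1), of "{i. Y \<in> w i}"]
      ultrafilter_on_mono[OF w _ that(2,3)] by blast
  have 5: "{i. X \<in> w i} \<in> u \<or> {i. T - X \<in> w i} \<in> u" if "X \<subseteq> T" for X
    using 3[OF that] ultrafilter_on_Diff[OF u, of "{i. X \<in> w i}"] by auto
  show ?thesis
    unfolding ultrafilter_on_def ultrafilter_limit_def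
    using 1 2 4 5 ultrafilter_on_carrier[OF u] ultrafilter_on_empty[OF u]
      ultrafilter_on_Int[OF u]
    by (auto simp: le_infI1)
qed

section \<open>The number of ultrafilters on the natural numbers\<close>

text \<open>Pick a point of difference for each pair of distinct members of A and list all of them.
  A list, not a set, is taken so that it can be coded by a number.\<close>

lemma separating_list:
  assumes "finite (A :: 'a set set)"
  shows "\<exists>l. inj_on (\<lambda>X. filter (\<lambda>x. x \<in> X) l) A"
proof -
  have "\<forall>X Y. \<exists>x. X \<noteq> Y \<longrightarrow> x \<in> X \<longleftrightarrow> x \<notin> Y" by blast
  then obtain d :: "'a set \<Rightarrow> 'a set \<Rightarrow> 'a"
    where d: "\<And>X Y. X \<noteq> Y \<Longrightarrow> d X Y \<in> X \<longleftrightarrow> d X Y \<notin> Y" by metis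
  have "finite ((\<lambda>(X, Y). d X Y) ` (A \<times> A))" using assms by blast
  from finite_list[OF this] obtain l where l: "set l = (\<lambda>(X, Y). d X Y) ` (A \<times> A)" ..
  have "X = Y" if "X \<in> A" "Y \<in> A" "filter (\<lambda>x. x \<in> X) l = filter (\<lambda>x. x \<in> Y) l" for X Y
  proof (rule ccontr)
    assume "X \<noteq> Y"
    have "set l \<inter> X = set l \<inter> Y"
      using arg_cong[OF that(3), of set] by (simp add: Int_def)
    moreover have "d X Y \<in> set l" using l that by force
    ultimately show False using d[OF \<open>X \<noteq> Y\<close>] by blast
  qed
  then show ?thesis unfolding inj_on_def by blast
qed

lemma Pow_Pow_lepoll_ultrafilters:
  "Pow (Pow (UNIV :: nat set)) \<lesssim> {u. ultrafilter_on (UNIV :: nat set) u}"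
proof -
  \<comment> \<open>Hausdorff's independent family: n codes a finite set l and a collection L of subsets
    of l, and n is in I X iff X meets l in a member of L.\<close>
  define c :: "nat \<Rightarrow> nat list \<times> nat list list" where "c = from_nat"
  define I where "I X = {n. filter (\<lambda>x. x \<in> X) (fst (c n)) \<in> set (snd (c n))}" for X
  \<comment> \<open>An ultrafilter containing \<open>F T\<close> remembers T, since it cannot
    contain both \<open>I X\<close> and its complement.\<close>
  define F where "F T = I ` T \<union> (\<lambda>X. - I X) ` (- T)" for T
  have "\<exists>u. ultrafilter_on UNIV u \<and> F T \<subseteq> u" for T
  proof (rule ultrafilter_on_extends)
    fix H assume H: "finite H" "H \<subseteq> F T"
    obtain A where A: "finite A" "A \<subseteq> T" "H \<inter> I ` T = I ` A"
      using H(1) finite_subset_image[of "H \<inter> I ` T" I T] by auto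
    obtain B where B: "finite B" "B \<subseteq> - T"
        "H \<inter> (\<lambda>X. - I X) ` (- T) = (\<lambda>X. - I X) ` B"
      using H(1) finite_subset_image[of "H \<inter> (\<lambda>X. - I X) ` (- T)" "\<lambda>X. - I X" "- T"] by auto
    have "H = (H \<inter> I ` T) \<union> (H \<inter> (\<lambda>X. - I X) ` (- T))"
      using H(2) unfolding F_def by blast
    then have H_eq: "H = I ` A \<union> (\<lambda>X. - I X) ` B"
      unfolding A(3) B(3) .
    obtain l where l: "inj_on (\<lambda>X. filter (\<lambda>x. x \<in> X) l) (A \<union> B)"
      using separating_list[of "A \<union> B"] A(1) B(1) by blast
    \<comment> \<open>L lists the traces on l of the members of A. Members of B have other traces,
      so the code of \<open>(l, L)\<close> lies in \<open>I X\<close> for X in A and outside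
      \<open>I X\<close> for X in B.\<close>
    obtain L where L: "set L = (\<lambda>X. filter (\<lambda>x. x \<in> X) l) ` A"
      using finite_list[OF finite_imageI[OF A(1)]] ..
    have cn: "c (to_nat (l, L)) = (l, L)" by (simp add: c_def)
    have "to_nat (l, L) \<in> I X" if "X \<in> A" for X
      using that L by (simp add: I_def cn)
    moreover have "to_nat (l, L) \<notin> I X" if X: "X \<in> B" for X
    proof
      assume "to_nat (l, L) \<in> I X"
      then obtain Y where "Y \<in> A" "filter (\<lambda>x. x \<in> X) l = filter (\<lambda>x. x \<in> Y) l"
        using L by (auto simp: I_def cn)
      then have "X = Y" using l X by (auto dest: inj_onD)
      then show False using A(2) B(2) X \<open>Y \<in> A\<close> by blast
    qed
    ultimately have "to_nat (l, L) \<in> \<Inter>H" unfolding H_eq by blast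
    then show "UNIV \<inter> \<Inter>H \<noteq> {}" by blast
  qed simp
  then obtain U where U: "\<And>T. ultrafilter_on UNIV (U T)" and FU: "\<And>T. F T \<subseteq> U T" by metis
  have "X \<in> T \<longleftrightarrow> I X \<in> U T" for X T
    using FU[of T] ultrafilter_on_disjoint[OF U, of "I X" T "- I X"]
    unfolding F_def by blast
  then have "inj U" by (intro injI) blast
  then show ?thesis
    unfolding lepoll_def using U by (intro exI[of _ U]) (auto intro: inj_on_subset)
qed

section \<open>Products of two primes\<close>

text \<open>Unique factorization, with the swapped matching of factors excluded by
  \<open>a \<noteq> b'\<close>.\<close>

lemma prime_mult_eq_cases:
  fixes a b a' b' :: nat
  assumes "prime a" "prime b" "prime a'" "prime b'" "a * b = a' * b'" "a \<noteq> b'"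
  shows "a = a' \<and> b = b'"
proof -
  have "a dvd a' * b'" using assms(5) by (metis dvd_triv_left)
  then have "a = a'"
    using assms by (metis prime_dvd_mult_iff primes_dvd_imp_eq)
  then show ?thesis using assms by (simp add: prime_gt_0_nat)
qed

lemma infinite_Primes: "infinite Primes"
  unfolding Primes_def by (rule primes_infinite)

lemma coprime_prod_subset_posnats:
  assumes "A \<subseteq> Primes" "B \<subseteq> Primes"
  shows "coprime_prod A B \<subseteq> posnats"
proof
  fix n assume "n \<in> coprime_prod A B"
  then obtain a b where "n = a * b" "a \<in> A" "b \<in> B" unfolding coprime_prod_def by blast
  moreover from this have "prime a" "prime b" using assms unfolding Primes_def by auto
  ultimately show "n \<in> posnats" by (simp add: posnats_def Suc_le_eq prime_gt_0_nat)
qed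

lemma mult_in_coprime_prod:
  assumes "A \<subseteq> Primes" "B \<subseteq> Primes" "A \<inter> B = {}" "a \<in> A" "b \<in> B"
  shows "a * b \<in> coprime_prod A B"
proof -
  have "prime a" "prime b" "a \<noteq> b" using assms unfolding Primes_def by auto
  then have "gcd a b = 1" using primes_coprime coprime_iff_gcd_eq_1 by blast
  then show ?thesis using assms(4,5) unfolding coprime_prod_def
    by (intro CollectI exI[of _ a] exI[of _ b]) auto
qed

section \<open>Splitting the primes, and an ultrafilter on finite sequences\<close>

lemma infinite_split:
  fixes S :: "nat set"
  assumes "infinite S"
  obtains E where "E \<subseteq> S" "infinite E" "infinite (S - E)"
proof -
  define h where "h = enumerate S"
  have h: "inj h" "range h = S"
    using bij_enumerate[OF assms] unfolding h_def bij_betw_def by auto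
  \<comment> \<open>E consists of the even positions of the increasing enumeration; the odd
    positions keep the complement infinite.\<close>
  have "range (\<lambda>n. h (2 * n + 1)) \<subseteq> S - range (\<lambda>n. h (2 * n))"
    using h by (auto dest!: injD[OF h(1)]) presburger
  moreover have "infinite (range (\<lambda>n. h (2 * n)))" "infinite (range (\<lambda>n. h (2 * n + 1)))"
    using h(1) by (auto intro!: range_inj_infinite injI dest!: injD[OF h(1)])
  ultimately show ?thesis
    using that[of "range (\<lambda>n. h (2 * n))"] h(2) finite_subset by blast
qed

text \<open>Cut the primes into two infinite halves; p contains one of them, and the other leaves
  room for coding.\<close>

lemma Primes_star_split:
  assumes "p \<in> Primes_star"
  obtains A where "A \<in> p" "A \<subseteq> Primes" "infinite (Primes - A)"
proof -
  have p: "ultrafilter_on posnats p" and Pp: "Primes \<in> p"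
    using assms unfolding Primes_star_def betaN_def by auto
  obtain E where E: "E \<subseteq> Primes" "infinite E" "infinite (Primes - E)"
    using infinite_split[OF infinite_Primes] .
  show ?thesis
  proof (cases "E \<in> p")
    case True
    then show ?thesis using that E by blast
  next
    case False
    then have "posnats - E \<in> p"
      using ultrafilter_on_Diff[OF p] ultrafilter_on_subset[OF p Pp] E(1) by blast
    then have "Primes \<inter> (posnats - E) \<in> p" using ultrafilter_on_Int[OF p Pp] by blast
    moreover have "Primes \<inter> (posnats - E) = Primes - E"
      using ultrafilter_on_subset[OF p Pp] by blast
    moreover have "Primes - (Primes - E) = E" using E by blast
    ultimately show ?thesis using that[of "Primes - E"] E by auto
  qed
qed

text \<open>Finitely many of these sets have a common subset of the same form: intersect the X and
  take the largest n. It is nonempty because members of a nonprincipal ultrafilter are infinite. The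
  length bound makes every coordinate defined on a set in v, and distinctness will tell the
  coordinates apart.\<close>

lemma ultrafilter_on_injective_lists:
  assumes p: "ultrafilter_on S p" and nonprincipal: "\<not> principal_on S p"
  obtains v where "ultrafilter_on UNIV v"
    and "\<And>X n. X \<in> p \<Longrightarrow> {s. distinct s \<and> set s \<subseteq> X \<and> n < length s} \<in> v"
proof -
  define G where "G X n = {s. distinct s \<and> set s \<subseteq> X \<and> n < length s}" for X :: "'a set" and n
  have "\<exists>v. ultrafilter_on UNIV v \<and> {G X n | X n. X \<in> p} \<subseteq> v"
  proof (rule ultrafilter_on_extends)
    fix H assume H: "finite H" "H \<subseteq> {G X n | X n. X \<in> p}"
    then have "\<exists>X n. X \<in> p \<and> G X n \<subseteq> \<Inter>H"
    proof (induction H rule: finite_induct)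
      case empty
      then show ?case using ultrafilter_on_carrier[OF p] by auto
    next
      case (insert K H)
      from insert.prems obtain Y m where "Y \<in> p" "K = G Y m" by blast
      moreover from insert.prems have "\<exists>X n. X \<in> p \<and> G X n \<subseteq> \<Inter>H" by (intro insert.IH) simp
      then obtain X n where "X \<in> p" "G X n \<subseteq> \<Inter>H" by blast
      ultimately have "X \<inter> Y \<in> p" "G (X \<inter> Y) (max n m) \<subseteq> \<Inter>(insert K H)"
        using ultrafilter_on_Int[OF p] unfolding G_def by auto
      then show ?case by blast
    qed
    then obtain X n where X: "X \<in> p" "G X n \<subseteq> \<Inter>H" by blast
    have "infinite X" using ultrafilter_on_finite_principal[OF p] nonprincipal X(1) by blast
    then obtain Y where Y: "finite Y" "card Y = Suc n" "Y \<subseteq> X"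
      using infinite_arbitrarily_large by blast
    then obtain s where "set s = Y" "distinct s" using finite_distinct_list by blast
    then have "s \<in> G X n" using Y distinct_card[of s] unfolding G_def by auto
    then show "UNIV \<inter> \<Inter>H \<noteq> {}" using X by blast
  qed simp
  then obtain v where v: "ultrafilter_on UNIV v" "{G X n | X n. X \<in> p} \<subseteq> v" by blast
  have "G X n \<in> v" if "X \<in> p" for X n using v(2) that by blast
  with v(1) show ?thesis unfolding G_def by (rule that)
qed

section \<open>Construction of q and of the ultrafilters above \<open>F11 p q\<close>\<close>

theorem theorem4p5:
  shows "\<forall>p\<in>Primes_star. \<exists>q\<in>Primes_star. q \<noteq> p \<and>
           {r \<in> betaN. F11 p q \<subseteq> r} \<approx> Pow (Pow (UNIV :: nat set))"
proof
  fix p assume p_star: "p \<in> Primes_star"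
  then have p: "ultrafilter_on posnats p" and np: "\<not> principal_on posnats p"
    and Pp: "Primes \<in> p"
    unfolding Primes_star_def betaN_def by auto
  have P_pos: "Primes \<subseteq> posnats" using ultrafilter_on_subset[OF p Pp] .
  obtain A0 where A0: "A0 \<in> p" "A0 \<subseteq> Primes" "infinite (Primes - A0)"
    using Primes_star_split[OF p_star] .
  define e :: "nat list \<Rightarrow> nat" where "e s = enumerate (Primes - A0) (to_nat s)" for s
  have e_in: "e s \<in> Primes - A0" for s
    unfolding e_def using A0(3) by (rule enumerate_in_set)
  have e_eq: "e s = e t \<longleftrightarrow> s = t" for s t
    unfolding e_def using bij_enumerate[OF A0(3)] by (simp add: bij_betw_def inj_eq)
  obtain v where v: "ultrafilter_on UNIV v"
    and vG: "\<And>X n. X \<in> p \<Longrightarrow> {s. distinct s \<and> set s \<subseteq> X \<and> n < length s} \<in> v"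
    using ultrafilter_on_injective_lists[OF p np] by metis
  have v_mono: "Y \<in> v" if "X \<in> v" "X \<subseteq> Y" for X Y
    using ultrafilter_on_mono[OF v that] by blast
  define q where "q = ultrafilter_image e posnats v"
  have e_vimage: "e -` (Primes - A0) = UNIV" "e -` Primes = UNIV" "e -` posnats = UNIV"
    using e_in P_pos by blast+
  have q: "ultrafilter_on posnats q"
    unfolding q_def by (rule ultrafilter_on_image[OF v])
      (simp add: e_vimage ultrafilter_on_carrier[OF v])
  have Pq: "Primes \<in> q" and Bq: "Primes - A0 \<in> q"
    using e_vimage P_pos ultrafilter_on_carrier[OF v] unfolding q_def ultrafilter_image_def
    by auto
  have "\<not> principal_on posnats q"
  proof
    assume "principal_on posnats q"
    then obtain a where a: "a \<in> posnats" "q = {X. X \<subseteq> posnats \<and> a \<in> X}"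
      unfolding principal_on_def by blast
    then have "e -` {a} \<in> v" unfolding q_def ultrafilter_image_def by blast
    \<comment> \<open>The fibre has at most one element t by injectivity of e, whereas v contains
      the set of injective lists of primes longer than t.\<close>
    moreover obtain t where "e -` {a} \<subseteq> {t}" using e_eq by blast
    ultimately have "{t} \<in> v" using v_mono by blast
    then show False
      using ultrafilter_on_disjoint[OF v _ vG[OF Pp, of "length t"]] by blast
  qed
  then have "q \<in> Primes_star" using q Pq unfolding Primes_star_def betaN_def by blast
  moreover have "q \<noteq> p" using ultrafilter_on_disjoint[OF p A0(1)] Bq by blast
  moreover have "{r \<in> betaN. F11 p q \<subseteq> r} \<approx> Pow (Pow (UNIV :: nat set))"
  proof (rule lepoll_antisym)
    \<comment> \<open>The right-hand side is the whole type of families of sets of naturals, so the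
      upper bound is an inclusion.\<close>
    show "{r \<in> betaN. F11 p q \<subseteq> r} \<lesssim> Pow (Pow (UNIV :: nat set))"
      by (rule subset_imp_lepoll) simp
  next
    define w where "w i = ultrafilter_image (\<lambda>s. s ! i * e s) posnats v" for i
    have w: "ultrafilter_on posnats (w i)" for i
      unfolding w_def
    proof (rule ultrafilter_on_image[OF v], rule v_mono[OF vG[OF Pp, of i]], rule subsetI)
      fix s :: "nat list"
      assume "s \<in> {s. distinct s \<and> set s \<subseteq> Primes \<and> i < length s}"
      then have "set s \<subseteq> Primes" "i < length s" by auto
      then have "s ! i \<in> posnats" "e s \<in> posnats" using e_in P_pos nth_mem by blast+
      then show "s \<in> (\<lambda>s. s ! i * e s) -` posnats" unfolding posnats_def by simp
    qed
    have F11_w: "F11 p q \<subseteq> w i" for i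
    proof
      fix Y assume "Y \<in> F11 p q"
      then obtain A B where Y: "Y = coprime_prod A B" and "A \<inter> B = {}"
        and "A \<in> restrict_family p Primes" "B \<in> restrict_family q Primes"
        unfolding F11_def by blast
      then have A: "A \<in> p" "A \<subseteq> Primes" and B: "B \<in> q" "B \<subseteq> Primes"
        using ultrafilter_on_Int[OF p _ Pp] ultrafilter_on_Int[OF q _ Pq]
        unfolding restrict_family_def by blast+
      \<comment> \<open>For s in this set, \<open>s ! i\<close> is in A and \<open>e s\<close> is in
        B. As A and B are disjoint sets of primes, the product is in
        \<open>coprime_prod A B\<close>, whatever i is.\<close>
      have "{s. distinct s \<and> set s \<subseteq> A \<and> i < length s} \<inter> e -` B \<in> v"
        using ultrafilter_on_Int[OF v vG[OF A(1)]] B(1)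
        unfolding q_def ultrafilter_image_def by blast
      then have "(\<lambda>s. s ! i * e s) -` Y \<in> v"
        by (rule v_mono)
          (use A B \<open>A \<inter> B = {}\<close> Y in
            \<open>auto intro!: mult_in_coprime_prod intro: subsetD nth_mem\<close>)
      then show "Y \<in> w i"
        using coprime_prod_subset_posnats[OF A(2) B(2)] Y
        unfolding w_def ultrafilter_image_def by blast
    qed
    define r where "r u = ultrafilter_limit u posnats w" for u
    have r: "r u \<in> {r \<in> betaN. F11 p q \<subseteq> r}" if u: "ultrafilter_on UNIV u" for u
    proof -
      have "F11 p q \<subseteq> r u"
      proof
        fix Y assume "Y \<in> F11 p q"
        then have "Y \<in> w i" for i using F11_w by blast
        then show "Y \<in> r u"
          using ultrafilter_on_subset[OF w] ultrafilter_on_carrier[OF u]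
          unfolding r_def ultrafilter_limit_def by simp
      qed
      moreover have "ultrafilter_on posnats (r u)"
        unfolding r_def using u w by (rule ultrafilter_on_limit)
      ultimately show ?thesis unfolding betaN_def by simp
    qed
    define G where "G i = {s. distinct s \<and> set s \<subseteq> A0 \<and> i < length s}" for i
    \<comment> \<open>\<open>Z I\<close> is the separating set: it will belong to \<open>w i\<close>
      exactly when i is in I. Entries are kept in A0 while codes avoid A0, so a product reveals
      which factor is which.\<close>
    define Z where "Z I = {s ! i * e s | i s. i \<in> I \<and> s \<in> G i}" for I
    have factors: "s ! i \<in> A0" "prime (s ! i)" "prime (e s)" if "s \<in> G i" for s i
    proof -
      show "s ! i \<in> A0" using that unfolding G_def by (auto intro: subsetD nth_mem)
      then show "prime (s ! i)" "prime (e s)"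
        using e_in[of s] A0(2) unfolding Primes_def by auto
    qed
    have Z_pos: "Z I \<subseteq> posnats" for I
      using factors unfolding Z_def posnats_def by (auto simp: Suc_le_eq prime_gt_0_nat)
    have Z_w: "Z I \<in> w i \<longleftrightarrow> i \<in> I" for I i
    proof
      assume "i \<in> I"
      then have "G i \<subseteq> (\<lambda>s. s ! i * e s) -` Z I" unfolding Z_def by blast
      then have "(\<lambda>s. s ! i * e s) -` Z I \<in> v"
        using v_mono vG[OF A0(1)] unfolding G_def by blast
      then show "Z I \<in> w i" using Z_pos unfolding w_def ultrafilter_image_def by blast
    next
      assume "Z I \<in> w i"
      then have "(\<lambda>s. s ! i * e s) -` Z I \<in> v" unfolding w_def ultrafilter_image_def by blast
      then obtain s where "s \<in> G i" "s ! i * e s \<in> Z I"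
        using ultrafilter_on_disjoint[OF v _ vG[OF A0(1), of i]] unfolding G_def by blast
      then obtain j t where jt: "j \<in> I" "t \<in> G j" "s ! i * e s = t ! j * e t"
        unfolding Z_def by blast
      have "s ! i \<noteq> e t" using factors(1)[OF \<open>s \<in> G i\<close>] e_in[of t] by auto
      then have "s ! i = t ! j \<and> e s = e t"
        using factors(2,3)[OF \<open>s \<in> G i\<close>] factors(2,3)[OF jt(2)] jt(3)
        by (intro prime_mult_eq_cases)
      \<comment> \<open>Equal codes give s = t, and a list with distinct entries has
        \<open>s ! i = s ! j\<close> only for i = j.\<close>
      then have "i = j"
        using \<open>s \<in> G i\<close> jt(2) e_eq unfolding G_def by (auto simp: nth_eq_iff_index_eq)
      then show "i \<in> I" using jt(1) by simp
    qed
    \<comment> \<open>The index set \<open>{i. Z I \<in> w i}\<close> is I itself, so u can be read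
      off from its limit.\<close>
    have "I \<in> u \<longleftrightarrow> Z I \<in> r u" for I u
      using Z_pos unfolding r_def ultrafilter_limit_def by (simp add: Z_w)
    then have "inj r" by (intro injI) blast
    then have "inj_on r {u. ultrafilter_on UNIV u}" by (rule inj_on_subset) simp
    moreover have "r ` {u. ultrafilter_on UNIV u} \<subseteq> {r \<in> betaN. F11 p q \<subseteq> r}"
      using r by blast
    ultimately have "{u. ultrafilter_on (UNIV :: nat set) u} \<lesssim> {r \<in> betaN. F11 p q \<subseteq> r}"
      unfolding lepoll_def by blast
    with Pow_Pow_lepoll_ultrafilters
    show "Pow (Pow (UNIV :: nat set)) \<lesssim> {r \<in> betaN. F11 p q \<subseteq> r}"
      by (rule lepoll_trans)
  qed
  ultimately show "\<exists>q\<in>Primes_star. q \<noteq> p \<and>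
      {r \<in> betaN. F11 p q \<subseteq> r} \<approx> Pow (Pow (UNIV :: nat set))" by blast
qed

end
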